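(* Let $n$ be a positive integer and let $G$ be an AG-group of order $n$. For $a\in G$ let $L_a:G\to G$, $L_a(x)=ax$. Then the left section $L_S=\{L_a : a\in G\}$ is an abelian group of order $n$ under composition of mappings.
   Context: An AG-group is a set $G$ with a binary operation (written as juxtaposition) such that: (i) $(xy)z=(zy)x$ for all $x,y,z\in G$ (left invertive law); (ii) there exists a left identity $e\in G$, i.e. $ex=x$ for all $x\in G$; (iii) for every $x\in G$ there exists $x^{-1}\in G$ such that $x^{-1}x=xx^{-1}=e$. Associativity and commutativity are not assumed. The order of $G$ is its cardinality. The product of two mappings is composition: $(fg)(x)=f(g(x))$. *)

theory Defs
  imports "HOL-Algebra.Coset"
begin

text \<open>The left identity is not part of the structure: it is only required to exist, and the
  inverses refer to that same left identity.\<close>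

locale ag_group =
  fixes G :: "'a set" and mult :: "'a \<Rightarrow> 'a \<Rightarrow> 'a" (infixl "\<cdot>" 70)
  assumes closed: "x \<in> G \<Longrightarrow> y \<in> G \<Longrightarrow> x \<cdot> y \<in> G"
    and left_invertive: "x \<in> G \<Longrightarrow> y \<in> G \<Longrightarrow> z \<in> G \<Longrightarrow> (x \<cdot> y) \<cdot> z = (z \<cdot> y) \<cdot> x"
    and identity_inverses:
      "\<exists>e\<in>G. (\<forall>x\<in>G. e \<cdot> x = x) \<and> (\<forall>x\<in>G. \<exists>y\<in>G. y \<cdot> x = e \<and> x \<cdot> y = e)"

text \<open>Mappings from \<open>G\<close> to \<open>G\<close> are represented by extensional functions, so that equality of
  mappings is equality on \<open>G\<close>.\<close>

definition left_translation :: "'a set \<Rightarrow> ('a \<Rightarrow> 'a \<Rightarrow> 'a) \<Rightarrow> 'a \<Rightarrow> ('a \<Rightarrow> 'a)" where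
  "left_translation G m a = (\<lambda>x\<in>G. m a x)"

definition left_section :: "'a set \<Rightarrow> ('a \<Rightarrow> 'a \<Rightarrow> 'a) \<Rightarrow> ('a \<Rightarrow> 'a) set" where
  "left_section G m = {left_translation G m a | a. a \<in> G}"

definition left_section_group :: "'a set \<Rightarrow> ('a \<Rightarrow> 'a \<Rightarrow> 'a) \<Rightarrow> ('a \<Rightarrow> 'a) monoid" where
  "left_section_group G m =
     \<lparr>carrier = left_section G m, monoid.mult = compose G, one = (\<lambda>x\<in>G. x)\<rparr>"

end

theory Submission imports Defs begin

text \<open>
  The left invertive law makes multiplication medial, and with a left identity \<open>e\<close> a medial
  operation satisfies \<open>x \<cdot> (y \<cdot> z) = y \<cdot> (x \<cdot> z)\<close>: any two left translations commute. The left
  invertive law and this exchange rewrite a composite of left translations as the single left translation by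
  \<open>(a \<cdot> e) \<cdot> b\<close>, so the left section is closed under composition. Since \<open>(a \<cdot> e) \<cdot> e = a\<close>, right
  multiplication by \<open>e\<close> is an involution. It follows that \<open>a\<close> can be recovered from the value of
  its translation at \<open>e\<close>, which gives the order, and that translation by \<open>a\<inverse> \<cdot> e\<close> inverts
  translation by \<open>a\<close>. Associativity is that of composition of mappings.
\<close>

lemma (in ag_group) medial:
  assumes "w \<in> G" "x \<in> G" "y \<in> G" "z \<in> G"
  shows "(w \<cdot> x) \<cdot> (y \<cdot> z) = (w \<cdot> y) \<cdot> (x \<cdot> z)"
proof -
  have "(w \<cdot> x) \<cdot> (y \<cdot> z) = ((y \<cdot> z) \<cdot> x) \<cdot> w"
    using assms by (intro left_invertive closed)
  also have "\<dots> = ((x \<cdot> z) \<cdot> y) \<cdot> w"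
    using assms left_invertive by simp
  also have "\<dots> = (w \<cdot> y) \<cdot> (x \<cdot> z)"
    using assms by (intro left_invertive closed)
  finally show ?thesis .
qed

text \<open>The left identity is a parameter here because the element whose translation is a given
  composite, or a given inverse, is written in terms of it.\<close>

locale ag_group_with_identity = ag_group +
  fixes e
  assumes e_closed: "e \<in> G"
    and left_identity: "x \<in> G \<Longrightarrow> e \<cdot> x = x"
    and left_inverse_exists: "x \<in> G \<Longrightarrow> \<exists>y\<in>G. y \<cdot> x = e"
begin

text \<open>Writing \<open>x\<close> and \<open>y\<close> as \<open>e \<cdot> x\<close> and \<open>e \<cdot> y\<close> turns this exchange into an instance of mediality.\<close>

lemma left_commute:
  assumes "x \<in> G" "y \<in> G" "z \<in> G"
  shows "x \<cdot> (y \<cdot> z) = y \<cdot> (x \<cdot> z)"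
  using medial[of e x y z] assms by (simp add: e_closed left_identity)

lemma right_mult_identity_twice:
  assumes "x \<in> G"
  shows "(x \<cdot> e) \<cdot> e = x"
  using left_invertive[of x e e] assms by (simp add: e_closed left_identity)

text \<open>This is the substitute for associativity. Under an associative multiplication the
  composite would be translation by \<open>a \<cdot> b\<close>; here the left invertive law reverses the outer
  factors, and exchange brings \<open>a\<close> back to the front because it occurs as \<open>a \<cdot> e\<close>.\<close>

lemma left_translations_compose:
  assumes "a \<in> G" "b \<in> G" "x \<in> G"
  shows "a \<cdot> (b \<cdot> x) = ((a \<cdot> e) \<cdot> b) \<cdot> x"
proof -
  have "((a \<cdot> e) \<cdot> b) \<cdot> x = (x \<cdot> b) \<cdot> (a \<cdot> e)"
    using assms by (intro left_invertive closed e_closed)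
  also have "\<dots> = a \<cdot> ((x \<cdot> b) \<cdot> e)"
    using assms by (intro left_commute closed e_closed)
  also have "\<dots> = a \<cdot> ((e \<cdot> b) \<cdot> x)"
    using assms left_invertive e_closed by simp
  finally show ?thesis
    using assms by (simp add: left_identity)
qed

lemma compose_left_translation:
  assumes "a \<in> G" "b \<in> G"
  shows "compose G (left_translation G (\<cdot>) a) (left_translation G (\<cdot>) b) =
    left_translation G (\<cdot>) ((a \<cdot> e) \<cdot> b)"
  using assms
  by (auto simp: compose_def left_translation_def closed left_translations_compose
      intro!: restrict_ext)

lemma compose_left_translation_commute:
  assumes "a \<in> G" "b \<in> G"
  shows "compose G (left_translation G (\<cdot>) a) (left_translation G (\<cdot>) b) =
    compose G (left_translation G (\<cdot>) b) (left_translation G (\<cdot>) a)"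
  using assms
  by (auto simp: compose_def left_translation_def closed intro!: restrict_ext left_commute)

lemma left_translation_identity: "left_translation G (\<cdot>) e = (\<lambda>x\<in>G. x)"
  by (auto simp: left_translation_def left_identity intro!: restrict_ext)

lemma left_translation_inverse:
  assumes "a \<in> G"
  shows "\<exists>b\<in>G. compose G (left_translation G (\<cdot>) b) (left_translation G (\<cdot>) a) = (\<lambda>x\<in>G. x)"
proof -
  obtain a' where a': "a' \<in> G" "a' \<cdot> a = e"
    using left_inverse_exists assms by blast
  \<comment> \<open>The factor \<open>e\<close> cancels the one that composition introduces: \<open>((a' \<cdot> e) \<cdot> e) \<cdot> a = a' \<cdot> a\<close>.\<close>
  have "compose G (left_translation G (\<cdot>) (a' \<cdot> e)) (left_translation G (\<cdot>) a) = (\<lambda>x\<in>G. x)"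
    using a' assms
    by (simp add: compose_left_translation closed e_closed right_mult_identity_twice
        left_translation_identity)
  then show ?thesis
    using a' closed e_closed by blast
qed

lemma left_translation_inj: "inj_on (left_translation G (\<cdot>)) G"
proof (rule inj_onI)
  fix a b assume "a \<in> G" "b \<in> G" and eq: "left_translation G (\<cdot>) a = left_translation G (\<cdot>) b"
  have "a \<cdot> e = b \<cdot> e"
    using fun_cong[OF eq, of e] e_closed by (simp add: left_translation_def)
  then show "a = b"
    using right_mult_identity_twice \<open>a \<in> G\<close> \<open>b \<in> G\<close> by metis
qed

lemma left_section_comm_group: "comm_group (left_section_group G (\<cdot>))"
proof (rule comm_groupI)
  let ?S = "left_section_group G (\<cdot>)"
  have carrierE: "\<exists>a\<in>G. f = left_translation G (\<cdot>) a" if "f \<in> carrier ?S" for f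
    using that by (auto simp: left_section_group_def left_section_def)
  have carrierI: "left_translation G (\<cdot>) a \<in> carrier ?S" if "a \<in> G" for a
    using that by (auto simp: left_section_group_def left_section_def)
  have mult: "f \<otimes>\<^bsub>?S\<^esub> g = compose G f g" for f g
    by (simp add: left_section_group_def)
  have one: "\<one>\<^bsub>?S\<^esub> = left_translation G (\<cdot>) e"
    by (simp add: left_section_group_def left_translation_identity)
  show "f \<otimes>\<^bsub>?S\<^esub> g \<in> carrier ?S" if "f \<in> carrier ?S" "g \<in> carrier ?S" for f g
    using carrierE[OF that(1)] carrierE[OF that(2)]
    by (auto simp: mult compose_left_translation closed e_closed intro!: carrierI)
  show "\<one>\<^bsub>?S\<^esub> \<in> carrier ?S"
    by (simp add: one carrierI e_closed)
  show "f \<otimes>\<^bsub>?S\<^esub> g \<otimes>\<^bsub>?S\<^esub> h = f \<otimes>\<^bsub>?S\<^esub> (g \<otimes>\<^bsub>?S\<^esub> h)"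
    if "f \<in> carrier ?S" "g \<in> carrier ?S" "h \<in> carrier ?S" for f g h
    using carrierE[OF that(3)]
    by (auto simp: mult compose_def left_translation_def closed intro!: restrict_ext)
  show "f \<otimes>\<^bsub>?S\<^esub> g = g \<otimes>\<^bsub>?S\<^esub> f" if "f \<in> carrier ?S" "g \<in> carrier ?S" for f g
    using carrierE[OF that(1)] carrierE[OF that(2)]
    by (auto simp: mult compose_left_translation_commute)
  show "\<one>\<^bsub>?S\<^esub> \<otimes>\<^bsub>?S\<^esub> f = f" if "f \<in> carrier ?S" for f
    using carrierE[OF that]
    by (auto simp: mult one compose_left_translation e_closed left_identity)
  show "\<exists>g\<in>carrier ?S. g \<otimes>\<^bsub>?S\<^esub> f = \<one>\<^bsub>?S\<^esub>" if f: "f \<in> carrier ?S" for f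
  proof -
    obtain a where a: "a \<in> G" "f = left_translation G (\<cdot>) a"
      using carrierE[OF f] by blast
    then show ?thesis
      using left_translation_inverse[OF a(1)] carrierI
      by (auto simp: mult one left_translation_identity)
  qed
qed

lemma order_left_section_group: "order (left_section_group G (\<cdot>)) = card G"
proof -
  have "carrier (left_section_group G (\<cdot>)) = left_translation G (\<cdot>) ` G"
    by (auto simp: left_section_group_def left_section_def)
  then show ?thesis
    by (simp add: order_def card_image left_translation_inj)
qed

end

theorem theorem1:
  fixes G :: "'a set" and m :: "'a \<Rightarrow> 'a \<Rightarrow> 'a" and n :: nat
  assumes "n > 0"
    and "ag_group G m"
    and "finite G" and "card G = n"
  shows "comm_group (left_section_group G m) \<and> order (left_section_group G m) = n"
proof -
  interpret ag_group G m by fact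
  obtain e where "e \<in> G" "\<forall>x\<in>G. m e x = x" "\<forall>x\<in>G. \<exists>y\<in>G. m y x = e"
    using identity_inverses by metis
  then interpret ag_group_with_identity G m e
    by unfold_locales auto
  show ?thesis
    using left_section_comm_group order_left_section_group \<open>card G = n\<close> by simp
qed

end
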